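(* For every open ball $B\subset\mathbb{R}^5$ there exists a complete Legendrian immersion $L\colon\mathbb{D}_1\to\mathbb{R}^5$ of the unit disk $\mathbb{D}_1=\{z\in\mathbb{C}:|z|<1\}$ with $L(\mathbb{D}_1)\subset B$.
   Context: $\mathbb{R}^5$ has coordinates $(x_1,y_1,x_2,y_2,t)$ and is equipped with its standard contact structure, the kernel of $\eta=dt-y_1\,dx_1-y_2\,dx_2$. A smooth immersion $L\colon\mathbb{D}_1\to\mathbb{R}^5$ of the (real $2$-dimensional) disk is Legendrian if $L^*\eta=0$, and complete if the pull-back by $L$ of the Euclidean metric of $\mathbb{R}^5$ is a complete Riemannian metric on $\mathbb{D}_1$. *)

theory Defs
  imports "HOL-Analysis.Analysis"
begin

text \<open>
  Continuous differentiability of order \<open>k\<close> on an open set, by recursion on the directional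
  derivatives. All derivatives are real Frechet derivatives, also when the domain is \<open>complex\<close>.
\<close>

fun Ck_on :: "nat \<Rightarrow> 'a::real_normed_vector set \<Rightarrow> ('a \<Rightarrow> 'b::real_normed_vector) \<Rightarrow> bool"
  where
    "Ck_on 0 U f \<longleftrightarrow> continuous_on U f"
  | "Ck_on (Suc k) U f \<longleftrightarrow>
       (\<forall>x\<in>U. f differentiable (at x)) \<and> (\<forall>v. Ck_on k U (\<lambda>x. frechet_derivative f (at x) v))"

definition smooth_on :: "'a::real_normed_vector set \<Rightarrow> ('a \<Rightarrow> 'b::real_normed_vector) \<Rightarrow> bool"
  where "smooth_on U f \<longleftrightarrow> (\<forall>k. Ck_on k U f)"

definition smooth_immersion_on ::
    "'a::real_normed_vector set \<Rightarrow> ('a \<Rightarrow> 'b::real_normed_vector) \<Rightarrow> bool"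
  where "smooth_immersion_on U f \<longleftrightarrow>
    smooth_on U f \<and> (\<forall>x\<in>U. inj (frechet_derivative f (at x)))"

text \<open>
  The coordinates \<open>(x\<^sub>1, y\<^sub>1, x\<^sub>2, y\<^sub>2, t)\<close> of a point \<open>p\<close> are \<open>(p $ 1, p $ 2, p $ 3, p $ 4, p $ 5)\<close>.
\<close>

definition contact_form :: "real^5 \<Rightarrow> real^5 \<Rightarrow> real"
  where "contact_form p v = v $ 5 - p $ 2 * v $ 1 - p $ 4 * v $ 3"

definition pullback_form ::
    "('a::real_normed_vector \<Rightarrow> 'b::real_normed_vector) \<Rightarrow> ('b \<Rightarrow> 'b \<Rightarrow> real) \<Rightarrow> 'a \<Rightarrow> 'a \<Rightarrow> real"
  where "pullback_form f \<omega> x v = \<omega> (f x) (frechet_derivative f (at x) v)"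

definition legendrian_on :: "'a::real_normed_vector set \<Rightarrow> ('a \<Rightarrow> real^5) \<Rightarrow> bool"
  where "legendrian_on U f \<longleftrightarrow> (\<forall>x\<in>U. \<forall>v. pullback_form f contact_form x v = 0)"

definition pullback_metric ::
    "('a::real_normed_vector \<Rightarrow> 'b::real_inner) \<Rightarrow> 'a \<Rightarrow> 'a \<Rightarrow> 'a \<Rightarrow> real"
  where "pullback_metric f x v w = frechet_derivative f (at x) v \<bullet> frechet_derivative f (at x) w"

text \<open>
  \<open>valid_path\<close> does not bound the derivative near the finitely many break points, so a path may
  have infinite length. The length is therefore \<open>ennreal\<close>-valued; a real-valued Henstock-Kurzweil
  or Bochner integral would assign length \<open>0\<close> to such a path.
\<close>

definition riemannian_length ::
    "('a::real_normed_vector \<Rightarrow> 'a \<Rightarrow> 'a \<Rightarrow> real) \<Rightarrow> (real \<Rightarrow> 'a) \<Rightarrow> ennreal"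
  where "riemannian_length g \<gamma> =
    (\<integral>\<^sup>+t\<in>{0..1}. ennreal (sqrt (g (\<gamma> t) (vector_derivative \<gamma> (at t within {0..1}))
                                    (vector_derivative \<gamma> (at t within {0..1})))) \<partial>lborel)"

text \<open>
  Meant for connected \<open>U\<close>. If no path joins \<open>x\<close> to \<open>y\<close> in \<open>U\<close> (in particular if one of
  them lies outside \<open>U\<close>) the value is \<open>enn2real \<infinity> = 0\<close>; \<open>Metric_space\<close> requires
  nonnegativity and symmetry outside of the carrier as well.
\<close>

definition riemannian_dist ::
    "'a::real_normed_vector set \<Rightarrow> ('a \<Rightarrow> 'a \<Rightarrow> 'a \<Rightarrow> real) \<Rightarrow> 'a \<Rightarrow> 'a \<Rightarrow> real"
  where "riemannian_dist U g x y =
    enn2real (INF \<gamma> \<in> {\<gamma>. valid_path \<gamma> \<and> path_image \<gamma> \<subseteq> U \<and> pathstart \<gamma> = x \<and> pathfinish \<gamma> = y}.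
      riemannian_length g \<gamma>)"

text \<open>
  The unfolding of \<open>Metric_space.mcomplete\<close> is available only for metric spaces, so
  \<open>Metric_space\<close> is part of the definition.
\<close>

definition complete_riemannian_metric ::
    "'a::real_normed_vector set \<Rightarrow> ('a \<Rightarrow> 'a \<Rightarrow> 'a \<Rightarrow> real) \<Rightarrow> bool"
  where "complete_riemannian_metric U g \<longleftrightarrow>
    Metric_space U (riemannian_dist U g) \<and> Metric_space.mcomplete U (riemannian_dist U g)"

definition complete_immersion_on ::
    "'a::real_normed_vector set \<Rightarrow> ('a \<Rightarrow> 'b::real_inner) \<Rightarrow> bool"
  where "complete_immersion_on U f \<longleftrightarrow>
    smooth_immersion_on U f \<and> complete_riemannian_metric U (pullback_metric f)"

abbreviation unit_disk :: "complex set"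
  where "unit_disk \<equiv> {z. cmod z < 1}"

end

theory Submission
  imports Defs
begin

text \<open>
  The plane figure eight \<open>(cos u, sin 2u)\<close> is immersed, and the integral of \<open>y dx\<close> over one period is
  zero, so it lifts to a closed Legendrian curve in \<open>\<real>\<^sup>3\<close>. Since the contact form of \<open>\<real>\<^sup>5\<close> splits, two
  scaled copies with independent parameters \<open>u\<close>, \<open>v\<close> and with the \<open>t\<close>-coordinates added form a
  doubly periodic Legendrian immersion of the \<open>(u, v)\<close>-plane into a small ball. By periodicity its
  differential expands all vectors by at least a fixed positive factor, so the induced metric of the
  plane is complete; precomposing with the diffeomorphism \<open>z \<mapsto> z / (1 - |z|\<^sup>2)\<close> from the disk onto
  the plane gives the result. The immersion need not be injective.
\<close>

section \<open>Calculus of \<open>C\<^sup>k\<close> functions\<close>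

text \<open>Openness of \<open>U\<close> matters because the derivative at a point sees values
  nearby: agreement on \<open>U\<close> then passes to all directional derivatives, so the induction
  has to generalize over both functions.\<close>

lemma Ck_on_cong:
  assumes "open U" "\<And>x. x \<in> U \<Longrightarrow> f x = g x" "Ck_on k U f"
  shows "Ck_on k U g"
  using assms(2,3)
proof (induction k arbitrary: f g)
  case 0
  then show ?case by (simp cong: continuous_on_cong)
next
  case (Suc k)
  have D: "(g has_derivative frechet_derivative f (at x)) (at x)" if "x \<in> U" for x
  proof (rule has_derivative_transform_within_open[OF _ \<open>open U\<close> that Suc.prems(1)])
    show "(f has_derivative frechet_derivative f (at x)) (at x)"
      using Suc.prems(2) that by (simp flip: frechet_derivative_works)
  qed
  have "Ck_on k U (\<lambda>x. frechet_derivative g (at x) v)" for v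
  proof (rule Suc.IH)
    show "frechet_derivative f (at x) v = frechet_derivative g (at x) v" if "x \<in> U" for x
      by (rule fun_cong[OF frechet_derivative_at[OF D[OF that]]])
    show "Ck_on k U (\<lambda>x. frechet_derivative f (at x) v)"
      using Suc.prems(2) by simp
  qed
  moreover have "g differentiable (at x)" if "x \<in> U" for x
    by (rule differentiableI[OF D[OF that]])
  ultimately show ?case by simp
qed

text \<open>Allows the derivative to be any explicit formula valid on \<open>U\<close>. The closure
  rules below all take the formula from a differentiation rule and treat its summands by
  induction.\<close>

lemma Ck_on_SucI:
  assumes "open U" "\<And>x. x \<in> U \<Longrightarrow> (f has_derivative f' x) (at x)" "\<And>v. Ck_on k U (\<lambda>x. f' x v)"
  shows "Ck_on (Suc k) U f"
proof -
  have "Ck_on k U (\<lambda>x. frechet_derivative f (at x) v)" for v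
    by (rule Ck_on_cong[OF assms(1) _ assms(3)[of v]]) (rule fun_cong[OF frechet_derivative_at[OF assms(2)]])
  moreover have "f differentiable (at x)" if "x \<in> U" for x
    by (rule differentiableI[OF assms(2)[OF that]])
  ultimately show ?thesis by simp
qed

lemma Ck_on_SucE:
  assumes "Ck_on (Suc k) U f"
  obtains f' where "\<And>x. x \<in> U \<Longrightarrow> (f has_derivative f' x) (at x)" "\<And>v. Ck_on k U (\<lambda>x. f' x v)"
proof (rule that[of "\<lambda>x. frechet_derivative f (at x)"])
  show "(f has_derivative frechet_derivative f (at x)) (at x)" if "x \<in> U" for x
    using assms that by (simp flip: frechet_derivative_works)
qed (use assms in simp)

text \<open>Needed because the derivative of a product or of a composite still contains the
  undifferentiated functions, which the induction requires at the lower order.\<close>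

lemma Ck_on_SucD: "Ck_on (Suc k) U f \<Longrightarrow> Ck_on k U f"
proof (induction k arbitrary: f)
  case 0
  then show ?case
    by (auto intro!: continuous_at_imp_continuous_on differentiable_imp_continuous_within)
qed auto

lemma Ck_on_const: "open U \<Longrightarrow> Ck_on k U (\<lambda>x. c)"
  by (induction k arbitrary: c) auto

lemma Ck_on_bounded_linear:
  assumes "open U" "bounded_linear T"
  shows "Ck_on k U T"
proof (cases k)
  case 0
  then show ?thesis using assms by (simp add: linear_continuous_on)
next
  case (Suc n)
  then show ?thesis
    using Ck_on_SucI[OF assms(1) bounded_linear_imp_has_derivative[OF assms(2)] Ck_on_const[OF assms(1)]]
    by (simp del: Ck_on.simps)
qed

lemma Ck_on_add:
  assumes "open U" "Ck_on k U f" "Ck_on k U g"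
  shows "Ck_on k U (\<lambda>x. f x + g x)"
  using assms(2,3)
proof (induction k arbitrary: f g)
  case 0
  then show ?case by (simp add: continuous_on_add)
next
  case (Suc k)
  obtain f' where f': "\<And>x. x \<in> U \<Longrightarrow> (f has_derivative f' x) (at x)" "\<And>v. Ck_on k U (\<lambda>x. f' x v)"
    using Suc.prems(1) by (rule Ck_on_SucE) blast
  obtain g' where g': "\<And>x. x \<in> U \<Longrightarrow> (g has_derivative g' x) (at x)" "\<And>v. Ck_on k U (\<lambda>x. g' x v)"
    using Suc.prems(2) by (rule Ck_on_SucE) blast
  show ?case
    by (rule Ck_on_SucI[OF \<open>open U\<close> has_derivative_add[OF f'(1) g'(1)]]) (assumption | intro Suc.IH f'(2) g'(2))+
qed

text \<open>By the product rule the derivative is \<open>B f g' + B f' g\<close>, a sum of two terms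
  of the same shape with one order less. Products, scalings and inner products are the instances
  used.\<close>

lemma Ck_on_bounded_bilinear:
  assumes "open U" "bounded_bilinear B" "Ck_on k U f" "Ck_on k U g"
  shows "Ck_on k U (\<lambda>x. B (f x) (g x))"
  using assms(3,4)
proof (induction k arbitrary: f g)
  case 0
  then show ?case by (simp add: bounded_bilinear.continuous_on[OF assms(2)])
next
  case (Suc k)
  obtain f' where f': "\<And>x. x \<in> U \<Longrightarrow> (f has_derivative f' x) (at x)" "\<And>v. Ck_on k U (\<lambda>x. f' x v)"
    using Suc.prems(1) by (rule Ck_on_SucE) blast
  obtain g' where g': "\<And>x. x \<in> U \<Longrightarrow> (g has_derivative g' x) (at x)" "\<And>v. Ck_on k U (\<lambda>x. g' x v)"
    using Suc.prems(2) by (rule Ck_on_SucE) blast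
  show ?case
    by (rule Ck_on_SucI[OF \<open>open U\<close> bounded_bilinear.FDERIV[OF assms(2) f'(1) g'(1)]])
      (assumption | intro Ck_on_add[OF \<open>open U\<close>] Suc.IH f'(2) g'(2) Ck_on_SucD[OF Suc.prems(1)] Ck_on_SucD[OF Suc.prems(2)])+
qed

lemmas Ck_on_mult = Ck_on_bounded_bilinear[OF _ bounded_bilinear_mult]
  and Ck_on_scaleR = Ck_on_bounded_bilinear[OF _ bounded_bilinear_scaleR]
  and Ck_on_inner = Ck_on_bounded_bilinear[OF _ bounded_bilinear_inner]

lemma Ck_on_bounded_linear_compose:
  assumes "open U" "bounded_linear T" "Ck_on k U f"
  shows "Ck_on k U (\<lambda>x. T (f x))"
  using assms(3)
proof (induction k arbitrary: f)
  case 0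
  then show ?case by (simp add: bounded_linear.continuous_on[OF assms(2)])
next
  case (Suc k)
  obtain f' where f': "\<And>x. x \<in> U \<Longrightarrow> (f has_derivative f' x) (at x)" "\<And>v. Ck_on k U (\<lambda>x. f' x v)"
    using Suc.prems by (rule Ck_on_SucE) blast
  show ?case
    by (rule Ck_on_SucI[OF \<open>open U\<close> bounded_linear.has_derivative[OF assms(2) f'(1)]]) (assumption | intro Suc.IH f'(2))+
qed

lemma Ck_on_diff:
  assumes "open U" "Ck_on k U f" "Ck_on k U g"
  shows "Ck_on k U (\<lambda>x. f x - g x)"
proof -
  note neg = Ck_on_bounded_linear_compose[OF assms(1) bounded_linear_minus[OF bounded_linear_ident] assms(3)]
  show ?thesis
    using Ck_on_add[OF assms(1,2) neg] by (simp only: add_uminus_conv_diff)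
qed

lemma Ck_on_power:
  fixes f :: "'a::real_normed_vector \<Rightarrow> 'b::real_normed_algebra_1"
  assumes "open U" "Ck_on k U f"
  shows "Ck_on k U (\<lambda>x. f x ^ n)"
proof (induction n)
  case 0
  show ?case using Ck_on_const[OF assms(1), of k 1] by simp
next
  case (Suc n)
  show ?case using Ck_on_mult[OF assms Suc] by simp
qed

lemma Ck_on_sum:
  assumes "open U" "\<And>i. i \<in> I \<Longrightarrow> Ck_on k U (f i)"
  shows "Ck_on k U (\<lambda>x. \<Sum>i\<in>I. f i x)"
  using assms(2)
proof (induction I rule: infinite_finite_induct)
  case (insert i I)
  have "Ck_on k U (\<lambda>x. f i x + (\<Sum>i\<in>I. f i x))"
    by (rule Ck_on_add[OF assms(1)]) (use insert in auto)
  then show ?case using insert.hyps by simp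
qed (simp_all add: Ck_on_const assms(1))

lemma Ck_on_componentwise:
  fixes f :: "'a::real_normed_vector \<Rightarrow> 'b::euclidean_space"
  assumes "open U" "\<And>b. b \<in> Basis \<Longrightarrow> Ck_on k U (\<lambda>x. f x \<bullet> b)"
  shows "Ck_on k U f"
proof -
  have "Ck_on k U (\<lambda>x. \<Sum>b\<in>Basis. (f x \<bullet> b) *\<^sub>R b)"
    using assms by (intro Ck_on_sum Ck_on_scaleR Ck_on_const) auto
  then show ?thesis by (simp add: euclidean_representation)
qed

lemma Ck_on_inverse:
  fixes f :: "'a::real_normed_vector \<Rightarrow> real"
  assumes "open U" "\<And>x. x \<in> U \<Longrightarrow> f x \<noteq> 0" "Ck_on k U f"
  shows "Ck_on k U (\<lambda>x. inverse (f x))"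
  using assms(3)
proof (induction k)
  case 0
  then show ?case using assms(2) by (simp add: continuous_on_inverse)
next
  case (Suc k)
  obtain f' where f': "\<And>x. x \<in> U \<Longrightarrow> (f has_derivative f' x) (at x)" "\<And>v. Ck_on k U (\<lambda>x. f' x v)"
    using Suc.prems by (rule Ck_on_SucE) blast
  \<comment> \<open>The derivative \<open>- (1/f) f' (1/f)\<close> contains the reciprocal itself,
    at an order where the induction hypothesis already covers it.\<close>
  have I: "Ck_on k U (\<lambda>x. inverse (f x))"
    by (rule Suc.IH[OF Ck_on_SucD[OF Suc.prems]])
  show ?case
    by (rule Ck_on_SucI[OF \<open>open U\<close> Deriv.has_derivative_inverse[OF assms(2) f'(1)]])
      (assumption | intro Ck_on_mult Ck_on_bounded_linear_compose[OF _ bounded_linear_minus[OF bounded_linear_ident]] I f'(2) \<open>open U\<close>)+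
qed

lemma Ck_on_sin_cos:
  fixes f :: "'a::real_normed_vector \<Rightarrow> real"
  assumes "open U" "Ck_on k U f"
  shows "Ck_on k U (\<lambda>x. sin (f x))" "Ck_on k U (\<lambda>x. cos (f x))"
proof -
  \<comment> \<open>Each of the two functions occurs in the derivative of the other, so the
    induction treats both at once.\<close>
  have "Ck_on k U (\<lambda>x. sin (f x)) \<and> Ck_on k U (\<lambda>x. cos (f x))"
    using assms(2)
  proof (induction k)
    case 0
    then show ?case by (simp add: continuous_on_sin continuous_on_cos)
  next
    case (Suc k)
    obtain f' where f': "\<And>x. x \<in> U \<Longrightarrow> (f has_derivative f' x) (at x)" "\<And>v. Ck_on k U (\<lambda>x. f' x v)"
      using Suc.prems by (rule Ck_on_SucE) blast
    have I: "Ck_on k U (\<lambda>x. sin (f x))" "Ck_on k U (\<lambda>x. cos (f x))"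
      using Suc.IH[OF Ck_on_SucD[OF Suc.prems]] by auto
    have "Ck_on (Suc k) U (\<lambda>x. sin (f x))"
      by (rule Ck_on_SucI[OF \<open>open U\<close> has_derivative_sin[OF f'(1)]])
        (assumption | intro Ck_on_mult I f'(2) \<open>open U\<close>)+
    moreover have "Ck_on (Suc k) U (\<lambda>x. cos (f x))"
      by (rule Ck_on_SucI[OF \<open>open U\<close> has_derivative_cos[OF f'(1)]])
        (assumption | intro Ck_on_mult Ck_on_bounded_linear_compose[OF _ bounded_linear_minus[OF bounded_linear_ident]] I f'(2) \<open>open U\<close>)+
    ultimately show ?case ..
  qed
  then show "Ck_on k U (\<lambda>x. sin (f x))" "Ck_on k U (\<lambda>x. cos (f x))" by auto
qed

section \<open>Lengths of paths and completeness of pullback metrics\<close>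

text \<open>The two-sided derivative suits the chain rule. For a valid path it agrees with the
  derivative within the unit interval off a finite set, so the integral is the same.\<close>

definition path_length :: "(real \<Rightarrow> 'a::real_normed_vector) \<Rightarrow> ennreal"
  where "path_length p = (\<integral>\<^sup>+t\<in>{0..1}. ennreal (norm (vector_derivative p (at t))) \<partial>lborel)"

lemma AE_lborel_not_in_finite: "finite S \<Longrightarrow> AE t in lborel. (t::real) \<notin> S"
  by (intro AE_not_in finite_imp_null_set_lborel)

text \<open>The endpoints are put into the exceptional set so that, for joined paths, the junction
  is excluded as well.\<close>

lemma valid_path_has_vector_derivative:
  assumes "valid_path p"
  obtains S where "finite S" "0 \<in> S" "1 \<in> S"
    "continuous_on ({0..1} - S) (\<lambda>t. vector_derivative p (at t))"
    "\<And>t. t \<in> {0..1} - S \<Longrightarrow> (p has_vector_derivative vector_derivative p (at t)) (at t)"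
proof -
  obtain S where S: "finite S" "p C1_differentiable_on ({0..1} - S)"
    using assms by (auto simp: valid_path_def piecewise_C1_differentiable_on_def)
  have "p C1_differentiable_on ({0..1} - (S \<union> {0, 1}))"
    using S(2) by (rule C1_differentiable_on_subset) auto
  with S(1) show thesis
    by (intro that[of "S \<union> {0, 1}"])
      (auto simp: C1_differentiable_on_eq vector_derivative_works)
qed

lemma borel_measurable_vector_derivative_valid_path:
  fixes p :: "real \<Rightarrow> 'a::euclidean_space"
  assumes "valid_path p"
  shows "(\<lambda>t. indicator {0..1} t *\<^sub>R vector_derivative p (at t)) \<in> borel_measurable borel"
proof -
  obtain S where S: "finite S" "continuous_on ({0..1} - S) (\<lambda>t. vector_derivative p (at t))"
    by (rule valid_path_has_vector_derivative[OF assms])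
  have "(\<lambda>t. indicator ({0..1} - S) t *\<^sub>R vector_derivative p (at t)) \<in> borel_measurable borel"
    using S by (intro borel_measurable_continuous_on_indicator) (auto simp: finite_imp_closed)
  \<comment> \<open>The exceptional set is finite, so changing the function there does not affect
    measurability.\<close>
  then show ?thesis
    by (rule measurable_discrete_difference[where X = S])
      (use S(1) in \<open>auto simp: indicator_def countable_finite\<close>)
qed

lemma borel_measurable_speed_valid_path:
  fixes p :: "real \<Rightarrow> 'a::euclidean_space"
  assumes "valid_path p"
  shows "(\<lambda>t. ennreal (norm (vector_derivative p (at t))) * indicator {0..1} t) \<in> borel_measurable borel"
proof -
  have "(\<lambda>t. ennreal (norm (indicator {0..1} t *\<^sub>R vector_derivative p (at t)))) \<in> borel_measurable borel"
    using borel_measurable_vector_derivative_valid_path[OF assms] by measurable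
  also have "(\<lambda>t. ennreal (norm (indicator {0..1} t *\<^sub>R vector_derivative p (at t)))) =
      (\<lambda>t. ennreal (norm (vector_derivative p (at t))) * indicator {0..1} t)"
    by (auto simp: indicator_def)
  finally show ?thesis .
qed

lemma path_length_reversepath:
  fixes p :: "real \<Rightarrow> 'a::euclidean_space"
  assumes "valid_path p"
  shows "path_length (reversepath p) = path_length p"
proof -
  let ?h = "\<lambda>p t. ennreal (norm (vector_derivative p (at t))) * indicator {0..1} t"
  obtain S where S: "finite S" "0 \<in> S" "1 \<in> S"
    and d: "\<And>t. t \<in> {0..1} - S \<Longrightarrow> (p has_vector_derivative vector_derivative p (at t)) (at t)"
    by (rule valid_path_has_vector_derivative[OF assms]) blast
  have "path_length p = (\<integral>\<^sup>+t. ?h p t \<partial>lborel)"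
    by (simp add: path_length_def)
  \<comment> \<open>Substitution \<open>t \<mapsto> 1 - t\<close>; the chain rule below contributes
    only a sign, which the norm removes.\<close>
  also have "\<dots> = (\<integral>\<^sup>+t. ?h p (1 + (-1) * t) \<partial>lborel)"
    by (subst nn_integral_real_affine[where c = "-1" and t = 1])
      (use borel_measurable_speed_valid_path[OF assms] in auto)
  also have "\<dots> = (\<integral>\<^sup>+t. ?h (reversepath p) t \<partial>lborel)"
  proof (rule nn_integral_cong_AE, use AE_lborel_not_in_finite[OF finite_imageI[OF S(1), of "\<lambda>t. 1 - t"]] in eventually_elim)
    case (elim t)
    show ?case
    proof (cases "t \<in> {0..1}")
      case True
      with elim have "1 - t \<in> {0..1} - S"
        by (auto simp: image_iff)
      from d[OF this] have "((p \<circ> (\<lambda>t. 1 - t)) has_vector_derivative (-1) *\<^sub>R vector_derivative p (at (1 - t))) (at t)"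
        by (intro vector_diff_chain_at derivative_eq_intros) (auto intro!: derivative_eq_intros)
      then have "vector_derivative (reversepath p) (at t) = - vector_derivative p (at (1 - t))"
        unfolding reversepath_def o_def by (auto intro: vector_derivative_at)
      then show ?thesis by (auto simp: indicator_def)
    qed (auto simp: indicator_def)
  qed
  finally show ?thesis by (simp add: path_length_def)
qed

lemma path_length_join:
  fixes p q :: "real \<Rightarrow> 'a::euclidean_space"
  assumes "valid_path p" "valid_path q"
  shows "path_length (p +++ q) = path_length p + path_length q"
proof -
  let ?h = "\<lambda>p t. ennreal (norm (vector_derivative p (at t))) * indicator {0..1} t"
  obtain S where S: "finite S" "0 \<in> S" "1 \<in> S"
    and dp: "\<And>t. t \<in> {0..1} - S \<Longrightarrow> (p has_vector_derivative vector_derivative p (at t)) (at t)"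
    by (rule valid_path_has_vector_derivative[OF assms(1)]) blast
  obtain T where T: "finite T" "0 \<in> T" "1 \<in> T"
    and dq: "\<And>t. t \<in> {0..1} - T \<Longrightarrow> (q has_vector_derivative vector_derivative q (at t)) (at t)"
    by (rule valid_path_has_vector_derivative[OF assms(2)]) blast
  have [measurable]: "?h p \<in> borel_measurable borel" "?h q \<in> borel_measurable borel"
    using assms by (auto intro: borel_measurable_speed_valid_path)
  \<comment> \<open>The substitutions \<open>2 * t\<close> and \<open>2 * t - 1\<close> move the two
    integrands to the two halves of the unit interval. Their factor 2 is the factor by which the
    joined path runs faster.\<close>
  have "path_length p + path_length q =
      2 * (\<integral>\<^sup>+t. ?h p (0 + 2 * t) \<partial>lborel) + 2 * (\<integral>\<^sup>+t. ?h q (-1 + 2 * t) \<partial>lborel)"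
    unfolding path_length_def
    by (subst nn_integral_real_affine[where c = 2 and t = 0], measurable,
        subst nn_integral_real_affine[where c = 2 and t = "-1"], measurable)
  also have "\<dots> = (\<integral>\<^sup>+t. 2 * ?h p (0 + 2 * t) + 2 * ?h q (-1 + 2 * t) \<partial>lborel)"
    by (subst nn_integral_add, measurable, subst (1 2) nn_integral_cmult, measurable)
  also have "\<dots> = (\<integral>\<^sup>+t. ?h (p +++ q) t \<partial>lborel)"
  proof (rule nn_integral_cong_AE, use AE_lborel_not_in_finite[OF finite_imageI[OF S(1), of "\<lambda>t. t / 2"]]
      AE_lborel_not_in_finite[OF finite_imageI[OF T(1), of "\<lambda>t. (t + 1) / 2"]] in eventually_elim)
    case (elim t)
    have nS: "2 * t \<notin> S"
      using elim(1) imageI[of "2 * t" S "\<lambda>t. t / 2"] by auto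
    have nT: "2 * t - 1 \<notin> T"
      using elim(2) imageI[of "2 * t - 1" T "\<lambda>t. (t + 1) / 2"] by auto
    have t12: "2 * t \<noteq> 1" using nS S by metis
    consider "t < 0 \<or> t > 1" | "0 \<le> t" "t < 1/2" | "1/2 < t" "t \<le> 1"
      using t12 by linarith
    then show ?case
    proof cases
      case 1
      then show ?thesis by (auto simp: indicator_def)
    next
      case 2
      have "((p \<circ> (\<lambda>t. 2 * t)) has_vector_derivative 2 *\<^sub>R vector_derivative p (at (2 * t))) (at t)"
        using 2 nS by (intro vector_diff_chain_at dp) (auto intro!: derivative_eq_intros)
      then have "((p +++ q) has_vector_derivative 2 *\<^sub>R vector_derivative p (at (2 * t))) (at t)"
        by (rule has_vector_derivative_transform_within_open[where S = "{..<1/2}"])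
          (use 2 in \<open>auto simp: joinpaths_def\<close>)
      from vector_derivative_at[OF this] show ?thesis
        using 2 by (auto simp: indicator_def ennreal_mult)
    next
      case 3
      have "((q \<circ> (\<lambda>t. 2 * t - 1)) has_vector_derivative 2 *\<^sub>R vector_derivative q (at (2 * t - 1))) (at t)"
        using 3 nT by (intro vector_diff_chain_at dq) (auto intro!: derivative_eq_intros)
      then have "((p +++ q) has_vector_derivative 2 *\<^sub>R vector_derivative q (at (2 * t - 1))) (at t)"
        by (rule has_vector_derivative_transform_within_open[where S = "{1/2<..}"])
          (use 3 in \<open>auto simp: joinpaths_def\<close>)
      from vector_derivative_at[OF this] show ?thesis
        using 3 by (auto simp: indicator_def ennreal_mult)
    qed
  qed
  finally show ?thesis by (simp add: path_length_def)
qed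

text \<open>The chord is the integral of the velocity, and the norm of an integral is at most the
  integral of the norm. Infinite length makes the claim trivial.\<close>

lemma norm_diff_le_path_length:
  fixes p :: "real \<Rightarrow> 'a::euclidean_space"
  assumes "valid_path p"
  shows "ennreal (norm (pathfinish p - pathstart p)) \<le> path_length p"
proof (cases "path_length p = \<infinity>")
  case False
  let ?v = "\<lambda>t. vector_derivative p (at t)"
  obtain S where S: "finite S" "0 \<in> S" "1 \<in> S"
    and d: "\<And>t. t \<in> {0..1} - S \<Longrightarrow> (p has_vector_derivative ?v t) (at t)"
    by (rule valid_path_has_vector_derivative[OF assms]) blast
  have "continuous_on {0..1} p"
    using valid_path_imp_path[OF assms] by (simp add: path_def)
  then have "(?v has_integral (p 1 - p 0)) {0..1}"
    using S(1) d by (intro fundamental_theorem_of_calculus_interior_strong[where S = S]) auto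
  moreover have eq: "(\<integral>\<^sup>+t. ennreal (norm (indicator {0..1} t *\<^sub>R ?v t)) \<partial>lborel) = path_length p"
    unfolding path_length_def by (intro nn_integral_cong) (auto simp: indicator_def)
  \<comment> \<open>The fundamental theorem yields only a Henstock-Kurzweil integral. Finite length
    makes the velocity Lebesgue integrable, and the two integrals then coincide.\<close>
  have int: "set_integrable lborel {0..1} ?v"
    unfolding set_integrable_def
    using borel_measurable_vector_derivative_valid_path[OF assms] False eq
    by (intro integrableI_bounded) (auto simp: less_top)
  ultimately have "p 1 - p 0 = (LINT t:{0..1}|lborel. ?v t)"
    using set_borel_integral_eq_integral[OF int] by (simp add: integral_unique)
  then have "ennreal (norm (p 1 - p 0)) \<le> (\<integral>\<^sup>+t. ennreal (norm (indicator {0..1} t *\<^sub>R ?v t)) \<partial>lborel)"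
    using int integral_norm_bound_ennreal[of lborel "\<lambda>t. indicator {0..1} t *\<^sub>R ?v t"]
    by (simp add: set_lebesgue_integral_def set_integrable_def)
  then show ?thesis
    unfolding eq by (simp add: pathfinish_def pathstart_def)
qed simp

section \<open>Paths and their lengths under continuously differentiable maps\<close>

lemma Ck_on_1D:
  assumes "Ck_on 1 U f"
  shows "\<And>x. x \<in> U \<Longrightarrow> (f has_derivative frechet_derivative f (at x)) (at x)"
    "\<And>v. continuous_on U (\<lambda>x. frechet_derivative f (at x) v)"
  using assms frechet_derivative_works by auto

text \<open>\<open>Ck_on\<close> gives continuity of the derivative only for each fixed direction.
  The expansion in a basis turns this into statements with varying directions, such as the
  velocities of a path.\<close>

lemma frechet_derivative_basis_sum:
  fixes f :: "'a::euclidean_space \<Rightarrow> 'b::real_normed_vector"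
  assumes "f differentiable (at x)"
  shows "frechet_derivative f (at x) v = (\<Sum>b\<in>Basis. (v \<bullet> b) *\<^sub>R frechet_derivative f (at x) b)"
proof -
  interpret linear "frechet_derivative f (at x)"
    using assms by (rule linear_frechet_derivative)
  have "frechet_derivative f (at x) (\<Sum>b\<in>Basis. (v \<bullet> b) *\<^sub>R b) = (\<Sum>b\<in>Basis. (v \<bullet> b) *\<^sub>R frechet_derivative f (at x) b)"
    by (simp add: sum scale)
  then show ?thesis by (simp add: euclidean_representation)
qed

lemma has_vector_derivative_compose_valid_path:
  fixes f :: "'a::real_normed_vector \<Rightarrow> 'b::real_normed_vector"
  assumes "Ck_on 1 U f" "\<gamma> t \<in> U"
    and "(\<gamma> has_vector_derivative w) (at t)"
  shows "((f \<circ> \<gamma>) has_vector_derivative frechet_derivative f (at (\<gamma> t)) w) (at t)"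
proof -
  have D: "(f has_derivative frechet_derivative f (at (\<gamma> t))) (at (\<gamma> t))"
    using Ck_on_1D(1)[OF assms(1,2)] .
  from diff_chain_at[OF assms(3)[unfolded has_vector_derivative_def] D] show ?thesis
    unfolding has_vector_derivative_def o_def
    using linear_frechet_derivative[of f "at (\<gamma> t)"] D
    by (simp add: linear_cmul differentiableI)
qed

lemma valid_path_compose_C1:
  fixes f :: "'a::euclidean_space \<Rightarrow> 'b::real_normed_vector"
  assumes f: "Ck_on 1 U f" and \<gamma>: "valid_path \<gamma>" "path_image \<gamma> \<subseteq> U"
  shows "valid_path (f \<circ> \<gamma>)"
proof -
  obtain S where S: "finite S"
    and c: "continuous_on ({0..1} - S) (\<lambda>t. vector_derivative \<gamma> (at t))"
    and d: "\<And>t. t \<in> {0..1} - S \<Longrightarrow> (\<gamma> has_vector_derivative vector_derivative \<gamma> (at t)) (at t)"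
    by (rule valid_path_has_vector_derivative[OF \<gamma>(1)]) blast
  have U: "\<gamma> t \<in> U" if "t \<in> {0..1}" for t
    using \<gamma>(2) that by (auto simp: path_image_def)
  have c\<gamma>: "continuous_on {0..1} \<gamma>"
    using valid_path_imp_path[OF \<gamma>(1)] by (simp add: path_def)
  have "continuous_on U f"
    using Ck_on_1D(1)[OF f] has_derivative_continuous continuous_at_imp_continuous_on by blast
  then have "continuous_on {0..1} (f \<circ> \<gamma>)"
    using c\<gamma> U by (intro continuous_on_compose) (auto intro: continuous_on_subset)
  moreover have "(f \<circ> \<gamma>) C1_differentiable_on ({0..1} - S)"
    unfolding C1_differentiable_on_def
  proof (intro exI conjI ballI)
    fix t assume t: "t \<in> {0..1} - S"
    then have "f differentiable (at (\<gamma> t))"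
      using Ck_on_1D(1)[OF f U, of t] by (auto simp: differentiableI)
    from has_vector_derivative_compose_valid_path[OF f U d[OF t]] t
    show "((f \<circ> \<gamma>) has_vector_derivative
        (\<Sum>b\<in>Basis. (vector_derivative \<gamma> (at t) \<bullet> b) *\<^sub>R frechet_derivative f (at (\<gamma> t)) b)) (at t)"
      by (simp flip: frechet_derivative_basis_sum[OF \<open>f differentiable _\<close>])
  next
    have "continuous_on ({0..1} - S) (\<lambda>t. frechet_derivative f (at (\<gamma> t)) b)" for b
      using U continuous_on_subset[OF c\<gamma>, of "{0..1} - S"]
      by (intro continuous_on_compose2[OF Ck_on_1D(2)[OF f]]) auto
    then show "continuous_on ({0..1} - S)
        (\<lambda>t. \<Sum>b\<in>Basis. (vector_derivative \<gamma> (at t) \<bullet> b) *\<^sub>R frechet_derivative f (at (\<gamma> t)) b)"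
      by (intro continuous_intros c)
  qed
  ultimately show ?thesis
    using S by (auto simp: valid_path_def piecewise_C1_differentiable_on_def)
qed

lemma sqrt_pullback_metric:
  "sqrt (pullback_metric f x v v) = norm (frechet_derivative f (at x) v)"
  by (simp add: pullback_metric_def norm_eq_sqrt_inner)

text \<open>The chain rule identifies the integrands almost everywhere. Questions about the pullback
  metric thereby become questions about Euclidean lengths in the target.\<close>

lemma riemannian_length_pullback_metric:
  fixes f :: "'a::euclidean_space \<Rightarrow> 'b::real_inner"
  assumes f: "Ck_on 1 U f" and \<gamma>: "valid_path \<gamma>" "path_image \<gamma> \<subseteq> U"
  shows "riemannian_length (pullback_metric f) \<gamma> = path_length (f \<circ> \<gamma>)"
proof -
  obtain S where S: "finite S"
    and d: "\<And>t. t \<in> {0..1} - S \<Longrightarrow> (\<gamma> has_vector_derivative vector_derivative \<gamma> (at t)) (at t)"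
    by (rule valid_path_has_vector_derivative[OF \<gamma>(1)]) blast
  have U: "\<gamma> t \<in> U" if "t \<in> {0..1}" for t
    using \<gamma>(2) that by (auto simp: path_image_def)
  show ?thesis
    unfolding riemannian_length_def path_length_def sqrt_pullback_metric
  proof (rule nn_integral_cong_AE, use AE_lborel_not_in_finite[OF S] in eventually_elim)
    case (elim t)
    show ?case
    proof (cases "t \<in> {0..1}")
      case True
      with elim have t: "t \<in> {0..1} - S" by auto
      have "vector_derivative \<gamma> (at t within {0..1}) = vector_derivative \<gamma> (at t)"
        using d[OF t] True by (intro vector_derivative_at_within_ivl) auto
      with vector_derivative_at[OF has_vector_derivative_compose_valid_path[OF f U[OF True] d[OF t]]]
      show ?thesis by simp
    qed auto
  qed
qed


section \<open>The distance induced by a pullback metric\<close>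

definition paths_in :: "'a::real_normed_vector set \<Rightarrow> 'a \<Rightarrow> 'a \<Rightarrow> (real \<Rightarrow> 'a) set"
  where "paths_in U x y =
    {\<gamma>. valid_path \<gamma> \<and> path_image \<gamma> \<subseteq> U \<and> pathstart \<gamma> = x \<and> pathfinish \<gamma> = y}"

text \<open>The distance before \<open>enn2real\<close>: if no path exists, the infimum is infinite
  rather than 0, so that inequalities between infima hold without side conditions.\<close>

definition riemannian_edist ::
    "'a::real_normed_vector set \<Rightarrow> ('a \<Rightarrow> 'a \<Rightarrow> 'a \<Rightarrow> real) \<Rightarrow> 'a \<Rightarrow> 'a \<Rightarrow> ennreal"
  where "riemannian_edist U g x y = (INF \<gamma> \<in> paths_in U x y. riemannian_length g \<gamma>)"

lemma riemannian_dist_eq_edist: "riemannian_dist U g x y = enn2real (riemannian_edist U g x y)"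
  by (simp add: riemannian_dist_def riemannian_edist_def paths_in_def)

lemma riemannian_edist_commute:
  fixes f :: "'a::euclidean_space \<Rightarrow> 'b::euclidean_space"
  assumes f: "Ck_on 1 U f"
  shows "riemannian_edist U (pullback_metric f) x y = riemannian_edist U (pullback_metric f) y x"
proof -
  have "riemannian_edist U (pullback_metric f) x y \<le> riemannian_edist U (pullback_metric f) y x" for x y
    unfolding riemannian_edist_def
  proof (rule INF_greatest)
    fix \<gamma> assume "\<gamma> \<in> paths_in U y x"
    then have \<gamma>: "valid_path \<gamma>" "path_image \<gamma> \<subseteq> U" and r: "reversepath \<gamma> \<in> paths_in U x y"
      by (auto simp: paths_in_def)
    have "riemannian_length (pullback_metric f) (reversepath \<gamma>) = path_length (reversepath (f \<circ> \<gamma>))"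
      using r by (subst riemannian_length_pullback_metric[OF f])
        (auto simp: paths_in_def path_compose_reversepath)
    also have "\<dots> = riemannian_length (pullback_metric f) \<gamma>"
      by (simp add: riemannian_length_pullback_metric[OF f \<gamma>] path_length_reversepath
          valid_path_compose_C1[OF f \<gamma>])
    finally show "(INF \<gamma> \<in> paths_in U x y. riemannian_length (pullback_metric f) \<gamma>)
        \<le> riemannian_length (pullback_metric f) \<gamma>"
      using r by (intro INF_lower2[of "reversepath \<gamma>"]) auto
  qed
  then show ?thesis by (intro antisym)
qed

lemma riemannian_edist_triangle:
  fixes f :: "'a::euclidean_space \<Rightarrow> 'b::euclidean_space"
  assumes f: "Ck_on 1 U f"
  shows "riemannian_edist U (pullback_metric f) x z \<le>
    riemannian_edist U (pullback_metric f) x y + riemannian_edist U (pullback_metric f) y z"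
proof -
  let ?l = "riemannian_length (pullback_metric f)"
  have join: "riemannian_edist U (pullback_metric f) x z \<le> ?l \<gamma>1 + ?l \<gamma>2"
    if "\<gamma>1 \<in> paths_in U x y" "\<gamma>2 \<in> paths_in U y z" for \<gamma>1 \<gamma>2
  proof -
    have \<gamma>1: "valid_path \<gamma>1" "path_image \<gamma>1 \<subseteq> U" and \<gamma>2: "valid_path \<gamma>2" "path_image \<gamma>2 \<subseteq> U"
      and j: "\<gamma>1 +++ \<gamma>2 \<in> paths_in U x z"
      using that by (auto simp: paths_in_def path_image_join valid_path_join)
    have "?l (\<gamma>1 +++ \<gamma>2) = path_length ((f \<circ> \<gamma>1) +++ (f \<circ> \<gamma>2))"
      using j by (subst riemannian_length_pullback_metric[OF f])
        (auto simp: paths_in_def path_compose_join)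
    also have "\<dots> = ?l \<gamma>1 + ?l \<gamma>2"
      by (simp add: riemannian_length_pullback_metric[OF f] \<gamma>1 \<gamma>2 path_length_join
          valid_path_compose_C1[OF f])
    finally show ?thesis
      unfolding riemannian_edist_def using j by (metis INF_lower)
  qed
  show ?thesis
  proof (rule ennreal_le_epsilon)
    \<comment> \<open>\<open>ennreal_le_epsilon\<close> permits the assumption that the right-hand
      side is finite. Hence both infima are approached to within \<open>e / 2\<close> by actual
      paths, which are then joined.\<close>
    fix e :: real assume e: "e > 0"
      and "riemannian_edist U (pullback_metric f) x y + riemannian_edist U (pullback_metric f) y z < top"
    then have fin: "riemannian_edist U (pullback_metric f) x y \<noteq> \<infinity>"
        "riemannian_edist U (pullback_metric f) y z \<noteq> \<infinity>"
      by auto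
    obtain \<gamma>1 where \<gamma>1: "\<gamma>1 \<in> paths_in U x y"
        "?l \<gamma>1 < riemannian_edist U (pullback_metric f) x y + ennreal (e / 2)"
      using INF_approx_ennreal[OF _ riemannian_edist_def fin(1), of "e / 2"] e by auto
    obtain \<gamma>2 where \<gamma>2: "\<gamma>2 \<in> paths_in U y z"
        "?l \<gamma>2 < riemannian_edist U (pullback_metric f) y z + ennreal (e / 2)"
      using INF_approx_ennreal[OF _ riemannian_edist_def fin(2), of "e / 2"] e by auto
    have "riemannian_edist U (pullback_metric f) x z \<le> ?l \<gamma>1 + ?l \<gamma>2"
      using \<gamma>1(1) \<gamma>2(1) by (rule join)
    also have "\<dots> \<le> (riemannian_edist U (pullback_metric f) x y + ennreal (e / 2)) +
        (riemannian_edist U (pullback_metric f) y z + ennreal (e / 2))"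
      using \<gamma>1(2) \<gamma>2(2) by (intro add_mono less_imp_le)
    also have "\<dots> = riemannian_edist U (pullback_metric f) x y + riemannian_edist U (pullback_metric f) y z +
        (ennreal (e / 2) + ennreal (e / 2))"
      by (simp add: ac_simps)
    also have "ennreal (e / 2) + ennreal (e / 2) = ennreal e"
      using e by (subst ennreal_plus[symmetric]) auto
    finally show "riemannian_edist U (pullback_metric f) x z \<le>
      riemannian_edist U (pullback_metric f) x y + riemannian_edist U (pullback_metric f) y z + ennreal e" .
  qed
qed

text \<open>Along any path, \<open>f\<close> moves at least \<open>\<delta>\<close> times as fast as
  \<open>\<phi>\<close>, so the \<open>f\<close>-length is at least \<open>\<delta>\<close> times
  the length of the \<open>\<phi>\<close>-image, and that is at least its chord.\<close>

lemma norm_diff_le_riemannian_edist: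
  fixes f :: "'a::euclidean_space \<Rightarrow> 'b::euclidean_space" and \<phi> :: "'a \<Rightarrow> 'c::euclidean_space"
  assumes f: "Ck_on 1 U f" and \<phi>: "Ck_on 1 U \<phi>" and "\<delta> > 0"
    and le: "\<And>x v. x \<in> U \<Longrightarrow> \<delta> * norm (frechet_derivative \<phi> (at x) v) \<le> norm (frechet_derivative f (at x) v)"
  shows "ennreal (\<delta> * norm (\<phi> x - \<phi> y)) \<le> riemannian_edist U (pullback_metric f) x y"
  unfolding riemannian_edist_def
proof (rule INF_greatest)
  fix \<gamma> assume "\<gamma> \<in> paths_in U x y"
  then have \<gamma>: "valid_path \<gamma>" "path_image \<gamma> \<subseteq> U" and xy: "\<gamma> 0 = x" "\<gamma> 1 = y"
    by (auto simp: paths_in_def pathstart_def pathfinish_def)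
  let ?v = "\<lambda>t. vector_derivative \<gamma> (at t within {0..1})"
  have "ennreal (\<delta> * norm (\<phi> x - \<phi> y)) = ennreal \<delta> * ennreal (norm (pathfinish (\<phi> \<circ> \<gamma>) - pathstart (\<phi> \<circ> \<gamma>)))"
    using \<open>\<delta> > 0\<close> xy by (simp add: ennreal_mult pathstart_def pathfinish_def norm_minus_commute)
  also have "\<dots> \<le> ennreal \<delta> * path_length (\<phi> \<circ> \<gamma>)"
    by (intro mult_left_mono norm_diff_le_path_length valid_path_compose_C1[OF \<phi> \<gamma>]) auto
  also have "\<dots> = ennreal \<delta> * (\<integral>\<^sup>+t\<in>{0..1}. ennreal (norm (vector_derivative (\<phi> \<circ> \<gamma>) (at t))) \<partial>lborel)"
    by (simp add: path_length_def)
  also have "\<dots> = (\<integral>\<^sup>+t\<in>{0..1}. ennreal \<delta> * ennreal (norm (vector_derivative (\<phi> \<circ> \<gamma>) (at t))) \<partial>lborel)"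
    using borel_measurable_speed_valid_path[OF valid_path_compose_C1[OF \<phi> \<gamma>]]
    by (subst nn_integral_cmult[symmetric]) (auto simp: mult.assoc)
  also have "\<dots> \<le> path_length (f \<circ> \<gamma>)"
  proof -
    obtain S where S: "finite S"
      and d: "\<And>t. t \<in> {0..1} - S \<Longrightarrow> (\<gamma> has_vector_derivative vector_derivative \<gamma> (at t)) (at t)"
      by (rule valid_path_has_vector_derivative[OF \<gamma>(1)]) blast
    have U: "\<gamma> t \<in> U" if "t \<in> {0..1}" for t
      using \<gamma>(2) that by (auto simp: path_image_def)
    show ?thesis
      unfolding path_length_def
    proof (rule nn_integral_mono_AE, use AE_lborel_not_in_finite[OF S] in eventually_elim)
      case (elim t)
      show ?case
      proof (cases "t \<in> {0..1}")
        case True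
        with elim have t: "t \<in> {0..1} - S" by auto
        show ?thesis
          using True le[OF U[OF True], of "vector_derivative \<gamma> (at t)"] \<open>\<delta> > 0\<close>
            vector_derivative_at[OF has_vector_derivative_compose_valid_path[OF f U[OF True] d[OF t]]]
            vector_derivative_at[OF has_vector_derivative_compose_valid_path[OF \<phi> U[OF True] d[OF t]]]
          by (simp add: ennreal_mult[symmetric] ennreal_leI)
      qed auto
    qed
  qed
  also have "\<dots> = riemannian_length (pullback_metric f) \<gamma>"
    by (simp add: riemannian_length_pullback_metric[OF f \<gamma>])
  finally show "ennreal (\<delta> * norm (\<phi> x - \<phi> y)) \<le> riemannian_length (pullback_metric f) \<gamma>" .
qed

text \<open>The straight segment stays in \<open>K\<close>, and by compactness the derivative of
  \<open>f\<close> is bounded there. This serves both for finiteness of the distance and for its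
  continuity.\<close>

lemma riemannian_edist_le_norm_diff:
  fixes f :: "'a::euclidean_space \<Rightarrow> 'b::real_inner"
  assumes f: "Ck_on 1 U f" and K: "compact K" "convex K" "K \<subseteq> U"
  obtains C where "C \<ge> 0"
    "\<And>x y. x \<in> K \<Longrightarrow> y \<in> K \<Longrightarrow> riemannian_edist U (pullback_metric f) x y \<le> ennreal (C * norm (y - x))"
proof -
  have "\<exists>M\<ge>0. \<forall>x\<in>K. norm (frechet_derivative f (at x) b) \<le> M" for b
  proof -
    have "compact ((\<lambda>x. frechet_derivative f (at x) b) ` K)"
      using Ck_on_1D(2)[OF f, of b] K by (intro compact_continuous_image) (auto intro: continuous_on_subset)
    then have "bounded ((\<lambda>x. frechet_derivative f (at x) b) ` K)"
      by (rule compact_imp_bounded)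
    then obtain B where "B > 0" "\<forall>y\<in>(\<lambda>x. frechet_derivative f (at x) b) ` K. norm y \<le> B"
      unfolding bounded_pos by blast
    then show ?thesis by (intro exI[of _ B]) auto
  qed
  then obtain M where M: "\<And>b. M b \<ge> 0" "\<And>b x. x \<in> K \<Longrightarrow> norm (frechet_derivative f (at x) b) \<le> M b"
    by metis
  define C where "C = (\<Sum>b\<in>Basis. M b)"
  have bound: "norm (frechet_derivative f (at x) v) \<le> C * norm v" if "x \<in> K" for x v
  proof -
    have "f differentiable (at x)"
      using Ck_on_1D(1)[OF f, of x] K(3) that by (auto intro: differentiableI)
    then have "norm (frechet_derivative f (at x) v) = norm (\<Sum>b\<in>Basis. (v \<bullet> b) *\<^sub>R frechet_derivative f (at x) b)"
      by (simp flip: frechet_derivative_basis_sum)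
    also have "\<dots> \<le> (\<Sum>b\<in>Basis. M b * norm v)"
    proof (rule sum_norm_le)
      fix b :: 'a assume "b \<in> Basis"
      then show "norm ((v \<bullet> b) *\<^sub>R frechet_derivative f (at x) b) \<le> M b * norm v"
        using mult_mono[OF Basis_le_norm M(2)[OF that]] by (simp add: mult.commute)
    qed
    finally show ?thesis by (simp add: C_def sum_distrib_right)
  qed
  show thesis
  proof
    show "C \<ge> 0" unfolding C_def by (intro sum_nonneg M)
    fix x y assume xy: "x \<in> K" "y \<in> K"
    then have seg: "closed_segment x y \<subseteq> K"
      using K(2) by (simp add: closed_segment_subset)
    then have "linepath x y \<in> paths_in U x y"
      using K(3) by (auto simp: paths_in_def)
    then have "riemannian_edist U (pullback_metric f) x y \<le> riemannian_length (pullback_metric f) (linepath x y)"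
      unfolding riemannian_edist_def by (rule INF_lower)
    also have "\<dots> \<le> (\<integral>\<^sup>+t. ennreal (C * norm (y - x)) * indicator {0..1::real} t \<partial>lborel)"
      unfolding riemannian_length_def sqrt_pullback_metric
    proof (rule nn_integral_mono)
      fix t :: real
      show "ennreal (norm (frechet_derivative f (at (linepath x y t)) (vector_derivative (linepath x y) (at t within {0..1}))))
          * indicator {0..1} t \<le> ennreal (C * norm (y - x)) * indicator {0..1} t"
      proof (cases "t \<in> {0..1}")
        case True
        then have "linepath x y t \<in> K" using seg linepath_in_path by blast
        then show ?thesis
          using bound True by (auto simp: vector_derivative_linepath_within intro: ennreal_leI)
      qed auto
    qed
    also have "\<dots> = ennreal (C * norm (y - x))"
      by (simp add: nn_integral_cmult)
    finally show "riemannian_edist U (pullback_metric f) x y \<le> ennreal (C * norm (y - x))" .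
  qed
qed


text \<open>A Cauchy sequence for the induced distance has a Euclidean Cauchy image under
  \<open>\<phi>\<close>, which is bounded. Properness confines the sequence to a compact subset of
  \<open>U\<close>, where some subsequence converges in the Euclidean sense, hence also in the
  induced distance; a Cauchy sequence with a convergent subsequence converges.\<close>

theorem complete_riemannian_metric_pullback_metric:
  fixes f :: "'a::euclidean_space \<Rightarrow> 'b::euclidean_space" and \<phi> :: "'a \<Rightarrow> 'c::euclidean_space"
  assumes U: "open U" "convex U"
    and f: "Ck_on 1 U f" and \<phi>: "Ck_on 1 U \<phi>" and inj: "inj_on \<phi> U" and "\<delta> > 0"
    and le: "\<And>x v. x \<in> U \<Longrightarrow> \<delta> * norm (frechet_derivative \<phi> (at x) v) \<le> norm (frechet_derivative f (at x) v)"
    and proper: "\<And>R. \<exists>K. compact K \<and> K \<subseteq> U \<and> {x \<in> U. norm (\<phi> x) \<le> R} \<subseteq> K"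
  shows "complete_riemannian_metric U (pullback_metric f)"
proof -
  let ?e = "riemannian_edist U (pullback_metric f)"
  let ?d = "riemannian_dist U (pullback_metric f)"
  have upper: "?d x y \<le> C * norm (y - x)" if "?e x y \<le> ennreal (C * norm (y - x))" "C \<ge> 0" for x y C
    using that enn2real_leI by (auto simp: riemannian_dist_eq_edist)
  \<comment> \<open>Finiteness is essential for lower bounds and for the triangle inequality, since
    \<open>enn2real\<close> sends infinity to 0.\<close>
  have fin: "?e x y < top" if "x \<in> U" "y \<in> U" for x y
  proof -
    have seg: "closed_segment x y \<subseteq> U"
      using U(2) that by (simp add: closed_segment_subset)
    obtain C where "\<And>a b. a \<in> closed_segment x y \<Longrightarrow> b \<in> closed_segment x y \<Longrightarrow>
        ?e a b \<le> ennreal (C * norm (b - a))"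
      by (rule riemannian_edist_le_norm_diff[OF f compact_segment convex_closed_segment seg]) blast
    from this[of x y] show ?thesis
      by (auto intro: le_less_trans)
  qed
  have lower: "\<delta> * norm (\<phi> x - \<phi> y) \<le> ?d x y" if "x \<in> U" "y \<in> U" for x y
  proof -
    have "ennreal (\<delta> * norm (\<phi> x - \<phi> y)) \<le> ?e x y"
      using norm_diff_le_riemannian_edist[OF f \<phi> \<open>\<delta> > 0\<close> le] .
    from enn2real_mono[OF this fin[OF that]] show ?thesis
      using \<open>\<delta> > 0\<close> by (simp add: riemannian_dist_eq_edist)
  qed
  \<comment> \<open>Local Lipschitz bound: Euclidean convergence implies convergence in the induced
    distance. With \<open>y = x\<close> it also gives distance 0 from a point to itself.\<close>
  have loc: "\<exists>\<epsilon>>0. \<exists>C. \<forall>y\<in>ball x \<epsilon>. y \<in> U \<and> ?d y x \<le> C * norm (x - y)" if x: "x \<in> U" for x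
  proof -
    obtain \<epsilon> where \<epsilon>: "\<epsilon> > 0" "cball x \<epsilon> \<subseteq> U"
      using U(1) x open_contains_cball by blast
    obtain C where C: "C \<ge> 0" "\<And>a b. a \<in> cball x \<epsilon> \<Longrightarrow> b \<in> cball x \<epsilon> \<Longrightarrow> ?e a b \<le> ennreal (C * norm (b - a))"
      by (rule riemannian_edist_le_norm_diff[OF f compact_cball convex_cball \<epsilon>(2)]) blast
    have "y \<in> U \<and> ?d y x \<le> C * norm (x - y)" if "y \<in> ball x \<epsilon>" for y
      using that \<epsilon> C by (intro conjI upper) auto
    then show ?thesis using \<epsilon>(1) by blast
  qed
  interpret Metric_space U ?d
  proof
    fix x y
    show "0 \<le> ?d x y" by (simp add: riemannian_dist_eq_edist)
    show "?d x y = ?d y x"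
      by (simp add: riemannian_dist_eq_edist riemannian_edist_commute[OF f, of x y])
    assume xy: "x \<in> U" "y \<in> U"
    show "?d x y = 0 \<longleftrightarrow> x = y"
    proof
      assume "?d x y = 0"
      then have "\<phi> x = \<phi> y"
        using lower[OF xy] \<open>\<delta> > 0\<close> by (simp add: mult_le_0_iff)
      then show "x = y" using inj xy by (auto dest: inj_onD)
    next
      assume "x = y"
      then show "?d x y = 0"
        using loc[OF xy(1)] enn2real_nonneg[of "?e x x"]
        by (auto simp: riemannian_dist_eq_edist intro!: antisym dest!: bspec[of _ _ x])
    qed
    fix z assume z: "z \<in> U"
    have "?d x z \<le> enn2real (?e x y + ?e y z)"
      unfolding riemannian_dist_eq_edist
      by (intro enn2real_mono riemannian_edist_triangle[OF f]) (simp add: fin xy z)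
    also have "\<dots> = ?d x y + ?d y z"
      by (simp add: riemannian_dist_eq_edist enn2real_plus fin xy z)
    finally show "?d x z \<le> ?d x y + ?d y z" .
  qed
  have mcomplete
    unfolding mcomplete_def
  proof (intro allI impI)
    fix \<sigma> assume \<sigma>: "MCauchy \<sigma>"
    then have \<sigma>U: "\<sigma> n \<in> U" for n
      by (auto simp: MCauchy_def)
    have "Cauchy (\<phi> \<circ> \<sigma>)"
      unfolding Cauchy_def
    proof (intro allI impI)
      fix e :: real assume "e > 0"
      then obtain N where N: "\<And>n n'. N \<le> n \<Longrightarrow> N \<le> n' \<Longrightarrow> ?d (\<sigma> n) (\<sigma> n') < \<delta> * e"
        using \<sigma> \<open>\<delta> > 0\<close> unfolding MCauchy_def by (meson mult_pos_pos)
      have "dist ((\<phi> \<circ> \<sigma>) m) ((\<phi> \<circ> \<sigma>) n) < e" if "m \<ge> N" "n \<ge> N" for m n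
      proof -
        have "\<delta> * dist ((\<phi> \<circ> \<sigma>) m) ((\<phi> \<circ> \<sigma>) n) < \<delta> * e"
          using lower[OF \<sigma>U \<sigma>U, of m n] N[OF that] by (simp add: dist_norm)
        then show ?thesis using \<open>\<delta> > 0\<close> by simp
      qed
      then show "\<exists>M. \<forall>m\<ge>M. \<forall>n\<ge>M. dist ((\<phi> \<circ> \<sigma>) m) ((\<phi> \<circ> \<sigma>) n) < e" by blast
    qed
    then have "bounded (range (\<phi> \<circ> \<sigma>))"
      by (rule cauchy_imp_bounded)
    then obtain R where R: "\<And>n. norm (\<phi> (\<sigma> n)) \<le> R"
      by (auto simp: bounded_iff)
    obtain K where K: "compact K" "K \<subseteq> U" "{x \<in> U. norm (\<phi> x) \<le> R} \<subseteq> K"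
      using proper by blast
    have "\<And>n. \<sigma> n \<in> K" using K(3) R \<sigma>U by auto
    then obtain l r where l: "l \<in> K" and r: "strict_mono (r :: nat \<Rightarrow> nat)" "(\<sigma> \<circ> r) \<longlonglongrightarrow> l"
      using K(1) unfolding compact_def by blast
    obtain \<epsilon> C where \<epsilon>: "\<epsilon> > 0" and C: "\<And>y. y \<in> ball l \<epsilon> \<Longrightarrow> ?d y l \<le> C * norm (l - y)"
      using loc l K(2) by blast
    have "((\<lambda>n. ?d ((\<sigma> \<circ> r) n) l) \<longlongrightarrow> 0) sequentially"
    proof (rule tendsto_sandwich[where f = "\<lambda>_. 0"])
      have "\<forall>\<^sub>F n in sequentially. (\<sigma> \<circ> r) n \<in> ball l \<epsilon>"
        using topological_tendstoD[OF r(2), of "ball l \<epsilon>"] \<epsilon> by simp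
      then show "\<forall>\<^sub>F n in sequentially. ?d ((\<sigma> \<circ> r) n) l \<le> C * norm (l - (\<sigma> \<circ> r) n)"
        by eventually_elim (rule C)
      have "(\<lambda>n. C * norm (l - (\<sigma> \<circ> r) n)) \<longlonglongrightarrow> C * norm (l - l)"
        by (intro tendsto_intros r(2))
      then show "(\<lambda>n. C * norm (l - (\<sigma> \<circ> r) n)) \<longlonglongrightarrow> 0" by simp
    qed auto
    then have "limitin mtopology (\<sigma> \<circ> r) l sequentially"
      using l K(2) \<sigma>U by (auto simp: limitin_metric_dist_null)
    then show "\<exists>x. limitin mtopology \<sigma> x sequentially"
      using MCauchy_convergent_subsequence[OF \<sigma> r(1)] by blast
  qed
  then show ?thesis
    using Metric_space_axioms by (simp add: complete_riemannian_metric_def)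
qed

section \<open>The diffeomorphism from the unit ball to the whole space\<close>

definition ball_dilation :: "'a::real_inner \<Rightarrow> 'a"
  where "ball_dilation x = inverse (1 - x \<bullet> x) *\<^sub>R x"

lemma norm_less_1_iff_inner: "norm x < 1 \<longleftrightarrow> x \<bullet> x < 1"
  by (simp add: norm_eq_sqrt_inner)

lemma Ck_on_ball_dilation: "Ck_on k (ball 0 1) (ball_dilation :: 'a::real_inner \<Rightarrow> 'a)"
proof -
  have id: "Ck_on k (ball 0 1) (\<lambda>x::'a. x)"
    by (rule Ck_on_bounded_linear[OF open_ball bounded_linear_ident])
  show ?thesis
    unfolding ball_dilation_def
    by (intro Ck_on_scaleR Ck_on_inverse Ck_on_diff Ck_on_const Ck_on_inner id open_ball)
      (simp add: norm_less_1_iff_inner)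
qed

lemma has_derivative_ball_dilation:
  fixes x :: "'a::real_inner"
  assumes "norm x < 1"
  shows "(ball_dilation has_derivative
    (\<lambda>v. inverse (1 - x \<bullet> x) *\<^sub>R v + (2 * (x \<bullet> v) * (inverse (1 - x \<bullet> x))\<^sup>2) *\<^sub>R x)) (at x)"
proof -
  let ?s = "inverse (1 - x \<bullet> x)"
  have d: "((\<lambda>x. 1 - x \<bullet> x) has_derivative (\<lambda>v. - (2 * (x \<bullet> v)))) (at x)"
    by (auto intro!: derivative_eq_intros simp: inner_commute)
  have "((\<lambda>x. inverse (1 - x \<bullet> x)) has_derivative (\<lambda>v. - (?s * - (2 * (x \<bullet> v)) * ?s))) (at x)"
    using assms by (intro Deriv.has_derivative_inverse d) (simp add: norm_less_1_iff_inner)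
  from has_derivative_scaleR[OF this has_derivative_ident] show ?thesis
    unfolding ball_dilation_def
    by (rule has_derivative_eq_rhs) (simp add: fun_eq_iff power2_eq_square mult_ac)
qed

lemma inj_ball_dilation_derivative:
  fixes x :: "'a::real_inner"
  assumes x: "norm x < 1"
  shows "inj (frechet_derivative ball_dilation (at x))"
proof -
  define s where "s = inverse (1 - x \<bullet> x)"
  have s: "s > 0" using x by (simp add: s_def norm_less_1_iff_inner)
  have eq: "frechet_derivative ball_dilation (at x) = (\<lambda>v. s *\<^sub>R v + (2 * (x \<bullet> v) * s\<^sup>2) *\<^sub>R x)"
    unfolding s_def using frechet_derivative_at[OF has_derivative_ball_dilation[OF x]] by simp
  have ker: "v = 0" if "s *\<^sub>R v + (2 * (x \<bullet> v) * s\<^sup>2) *\<^sub>R x = 0" for v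
  proof -
    \<comment> \<open>The derivative is a positive multiple of the identity plus a positive
      semidefinite rank-one term, so pairing with \<open>v\<close> detects every nonzero
      \<open>v\<close>.\<close>
    have "s * (v \<bullet> v) + 2 * s\<^sup>2 * (x \<bullet> v)\<^sup>2 = (s *\<^sub>R v + (2 * (x \<bullet> v) * s\<^sup>2) *\<^sub>R x) \<bullet> v"
      by (simp add: inner_add_left power2_eq_square)
    also have "\<dots> = 0" using that by simp
    finally have "s * (v \<bullet> v) \<le> 0"
      by (smt (verit) mult_nonneg_nonneg zero_le_power2)
    then have "v \<bullet> v \<le> 0" using s by (simp add: mult_le_0_iff)
    then show "v = 0" by (metis inner_gt_zero_iff not_less)
  qed
  have lin: "linear (frechet_derivative ball_dilation (at x))"
    using has_derivative_ball_dilation[OF x] by (intro linear_frechet_derivative differentiableI)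
  show ?thesis
    unfolding linear_injective_0[OF lin] unfolding eq using ker by blast
qed

lemma inj_on_ball_dilation: "inj_on ball_dilation (ball (0::'a::real_inner) 1)"
proof (rule inj_onI)
  \<comment> \<open>The norm of the image is strictly increasing in the norm of the point. Equal
    images thus force equal norms, hence equal scaling factors, hence equal points.\<close>
  have le: "norm y \<le> norm x"
    if "norm x < 1" "norm y < 1" "ball_dilation x = ball_dilation y" for x y :: 'a
  proof (rule ccontr)
    assume "\<not> norm y \<le> norm x"
    then have xy: "norm x < norm y" by simp
    then have "x \<bullet> x < y \<bullet> y" by (simp add: norm_eq_sqrt_inner)
    moreover have y: "y \<bullet> y < 1" using that(2) by (simp add: norm_less_1_iff_inner)
    ultimately have "inverse (1 - x \<bullet> x) \<le> inverse (1 - y \<bullet> y)" by simp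
    then have "inverse (1 - x \<bullet> x) * norm x \<le> inverse (1 - y \<bullet> y) * norm x"
      by (intro mult_right_mono) auto
    also have "\<dots> < inverse (1 - y \<bullet> y) * norm y"
      using xy y by simp
    finally show False
      using arg_cong[OF that(3), of norm] y that(1)
      by (simp add: ball_dilation_def norm_less_1_iff_inner)
  qed
  fix x y :: 'a
  assume xy: "x \<in> ball 0 1" "y \<in> ball 0 1" and eq: "ball_dilation x = ball_dilation y"
  then have "norm x = norm y" by (intro antisym le) auto
  then have "x \<bullet> x = y \<bullet> y" by (simp add: norm_eq_sqrt_inner)
  then show "x = y"
    using eq xy by (auto simp: ball_dilation_def norm_less_1_iff_inner)
qed

lemma ball_dilation_proper:
  "\<exists>K. compact K \<and> K \<subseteq> ball 0 1 \<and> {x \<in> ball 0 1. norm (ball_dilation x) \<le> R} \<subseteq> (K :: 'a::euclidean_space set)"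
proof (intro exI conjI)
  \<comment> \<open>Clearing the denominator gives a closed condition on the closed ball. On the
    unit sphere it reads \<open>1 \<le> 0\<close>, so the compact set avoids the boundary.\<close>
  let ?K = "cball 0 1 \<inter> {x::'a. norm x \<le> R * (1 - x \<bullet> x)}"
  show "compact ?K"
    by (intro compact_Int_closed compact_cball closed_Collect_le continuous_intros)
  show "?K \<subseteq> ball 0 1"
  proof
    fix x assume x: "x \<in> ?K"
    have "norm x \<noteq> 1"
    proof
      assume n: "norm x = 1"
      then have "x \<bullet> x = 1" by (simp add: norm_eq_1)
      with x n show False by simp
    qed
    with x show "x \<in> ball 0 1" by simp
  qed
  show "{x \<in> ball 0 1. norm (ball_dilation x) \<le> R} \<subseteq> ?K"
  proof safe
    fix x :: 'a
    assume x: "x \<in> ball 0 1" and R: "norm (ball_dilation x) \<le> R"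
    from x show "x \<in> cball 0 1" by simp
    from x have "x \<bullet> x < 1" by (simp add: norm_less_1_iff_inner)
    with R show "norm x \<le> R * (1 - x \<bullet> x)"
      by (simp add: ball_dilation_def field_simps)
  qed
qed

section \<open>The doubly periodic Legendrian immersion\<close>

lemma exhaust_5: "(x::5) = 1 \<or> x = 2 \<or> x = 3 \<or> x = 4 \<or> x = 5"
proof (induct x)
  case (of_int z)
  \<comment> \<open>Representatives run from 0 to 4, and 0 equals 5 in this index type.\<close>
  then have "z = 0 \<or> z = 1 \<or> z = 2 \<or> z = 3 \<or> z = 4" by fastforce
  then show ?case by auto
qed

lemma UNIV_5: "UNIV = {1, 2, 3, 4, 5::5}"
  using exhaust_5 by auto

lemma sum_5: "sum f (UNIV::5 set) = f 1 + f 2 + f 3 + f 4 + f 5"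
  unfolding UNIV_5 by (simp add: ac_simps)

lemma vector_5 [simp]:
  fixes a b c d e :: "'a::zero"
  shows "(vector [a, b, c, d, e] :: 'a^5) $ 1 = a"
    "(vector [a, b, c, d, e] :: 'a^5) $ 2 = b"
    "(vector [a, b, c, d, e] :: 'a^5) $ 3 = c"
    "(vector [a, b, c, d, e] :: 'a^5) $ 4 = d"
    "(vector [a, b, c, d, e] :: 'a^5) $ 5 = e"
  unfolding vector_def by simp_all

text \<open>The last coordinate is a primitive of
  \<open>y\<^sub>1 dx\<^sub>1 + y\<^sub>2 dx\<^sub>2\<close>: the constants \<open>c $ 2\<close> and
  \<open>c $ 4\<close> produce the cosine terms, and \<open>- sin (2 * u) * sin u\<close> integrates
  to \<open>- 2 / 3 * sin u ^ 3\<close>.\<close>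

definition figure_eight_torus :: "real^5 \<Rightarrow> real \<Rightarrow> complex \<Rightarrow> real^5"
  where "figure_eight_torus c \<epsilon> w = (let u = Re w; v = Im w in vector
    [c $ 1 + \<epsilon> * cos u, c $ 2 + \<epsilon> * sin (2 * u), c $ 3 + \<epsilon> * cos v, c $ 4 + \<epsilon> * sin (2 * v),
     c $ 5 + c $ 2 * \<epsilon> * cos u + c $ 4 * \<epsilon> * cos v - 2 / 3 * \<epsilon>\<^sup>2 * (sin u ^ 3 + sin v ^ 3)])"

text \<open>The last entry is written as \<open>y\<^sub>1 dx\<^sub>1 + y\<^sub>2 dx\<^sub>2\<close>
  evaluated at \<open>h\<close>, so the Legendrian condition becomes an identity of polynomials in
  the entries.\<close>

definition figure_eight_torus' :: "real^5 \<Rightarrow> real \<Rightarrow> complex \<Rightarrow> complex \<Rightarrow> real^5"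
  where "figure_eight_torus' c \<epsilon> w h = (let u = Re w; v = Im w in vector
    [- \<epsilon> * sin u * Re h, 2 * \<epsilon> * cos (2 * u) * Re h, - \<epsilon> * sin v * Im h, 2 * \<epsilon> * cos (2 * v) * Im h,
     - (c $ 2 + \<epsilon> * sin (2 * u)) * \<epsilon> * sin u * Re h - (c $ 4 + \<epsilon> * sin (2 * v)) * \<epsilon> * sin v * Im h])"

text \<open>Double angles are expanded because the derivative of \<open>sin u ^ 3\<close> has to be
  matched with \<open>sin (2 * u) * sin u\<close>.\<close>

lemma has_derivative_figure_eight_torus:
  "(figure_eight_torus c \<epsilon> has_derivative figure_eight_torus' c \<epsilon> w) (at w)"
proof -
  have sin_double': "sin (u * 2) = 2 * sin u * cos u" for u :: real
    by (metis mult.commute sin_double)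
  have cos_double': "cos (u * 2) = cos u * cos u - sin u * sin u" for u :: real
    by (metis mult.commute cos_double power2_eq_square)
  have "((\<lambda>w. figure_eight_torus c \<epsilon> w $ i) has_derivative (\<lambda>h. figure_eight_torus' c \<epsilon> w h $ i)) (at w)" for i
    using exhaust_5[of i]
    by (elim disjE)
      (auto simp: figure_eight_torus_def figure_eight_torus'_def Let_def sin_double' cos_double' power2_eq_square
        algebra_simps fun_eq_iff intro!: derivative_eq_intros)
  then show ?thesis
    by (subst has_derivative_componentwise_within) (auto simp: Basis_vec_def inner_axis)
qed

lemma contact_form_figure_eight_torus':
  "contact_form (figure_eight_torus c \<epsilon> w) (figure_eight_torus' c \<epsilon> w h) = 0"
  by (simp add: contact_form_def figure_eight_torus_def figure_eight_torus'_def Let_def algebra_simps)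

lemma norm_figure_eight_torus'_ge:
  assumes "\<epsilon> > 0"
  shows "\<epsilon> / 2 * norm h \<le> norm (figure_eight_torus' c \<epsilon> w h)"
proof -
  \<comment> \<open>Squared speed of the unscaled figure eight. With
    \<open>s = (sin u)\<^sup>2\<close> it is \<open>16 s\<^sup>2 - 15 s + 4\<close>; completing the
    square bounds it by \<open>31 / 64\<close>, and \<open>1 / 4\<close> is a convenient smaller
    square.\<close>
  have speed: "(sin u)\<^sup>2 + 4 * (cos (2 * u))\<^sup>2 \<ge> 1 / 4" for u :: real
  proof -
    have "(sin u)\<^sup>2 + 4 * (cos (2 * u))\<^sup>2 = (4 * (sin u)\<^sup>2 - 15 / 8)\<^sup>2 + 31 / 64"
      unfolding cos_double_sin by (simp add: power2_eq_square algebra_simps)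
    then show ?thesis using zero_le_power2[of "4 * (sin u)\<^sup>2 - 15 / 8"] by linarith
  qed
  let ?X = "figure_eight_torus' c \<epsilon> w h"
  have "(\<epsilon> / 2 * norm h)\<^sup>2 = \<epsilon>\<^sup>2 * (1 / 4 * (Re h)\<^sup>2 + 1 / 4 * (Im h)\<^sup>2)"
    by (simp add: power_mult_distrib cmod_power2 power_divide field_simps)
  also have "\<dots> \<le> \<epsilon>\<^sup>2 * (((sin (Re w))\<^sup>2 + 4 * (cos (2 * Re w))\<^sup>2) * (Re h)\<^sup>2
      + ((sin (Im w))\<^sup>2 + 4 * (cos (2 * Im w))\<^sup>2) * (Im h)\<^sup>2)"
    by (intro mult_left_mono add_mono mult_right_mono speed) auto
  also have "\<dots> = (?X $ 1)\<^sup>2 + (?X $ 2)\<^sup>2 + (?X $ 3)\<^sup>2 + (?X $ 4)\<^sup>2"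
    by (simp add: figure_eight_torus'_def Let_def power_mult_distrib algebra_simps)
  \<comment> \<open>The fifth component is discarded; the two plane curves alone give the
    expansion.\<close>
  also have "\<dots> \<le> ?X \<bullet> ?X"
    by (simp add: inner_vec_def sum_5 power2_eq_square)
  also have "\<dots> = (norm ?X)\<^sup>2" by (simp add: power2_norm_eq_inner)
  finally show ?thesis by (rule power2_le_imp_le) simp
qed

lemma Ck_on_figure_eight_torus:
  assumes U: "open U" and \<phi>: "Ck_on k U \<phi>"
  shows "Ck_on k U (\<lambda>x. figure_eight_torus c \<epsilon> (\<phi> x))"
proof (rule Ck_on_componentwise[OF U])
  have Re: "Ck_on k U (\<lambda>x. Re (\<phi> x))" and Im: "Ck_on k U (\<lambda>x. Im (\<phi> x))"
    by (fact Ck_on_bounded_linear_compose[OF U bounded_linear_Re \<phi>]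
        Ck_on_bounded_linear_compose[OF U bounded_linear_Im \<phi>])+
  have "Ck_on k U (\<lambda>x. figure_eight_torus c \<epsilon> (\<phi> x) $ i)" for i
    using exhaust_5[of i]
    by (elim disjE; simp only: figure_eight_torus_def Let_def vector_5;
        intro Ck_on_add Ck_on_diff Ck_on_mult Ck_on_power Ck_on_const Ck_on_sin_cos Re Im U)
  then show "Ck_on k U (\<lambda>x. figure_eight_torus c \<epsilon> (\<phi> x) \<bullet> b)" if "b \<in> Basis" for b
    using that by (auto simp: Basis_vec_def inner_axis)
qed

text \<open>The first four coordinates move by at most \<open>\<epsilon>\<close> each. The fifth
  also depends on \<open>c\<close>, and its quadratic term is at most linear because
  \<open>\<epsilon> \<le> 1\<close>.\<close>

lemma norm_figure_eight_torus_diff_le: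
  assumes "0 < \<epsilon>" "\<epsilon> \<le> 1"
  shows "norm (figure_eight_torus c \<epsilon> w - c) \<le> \<epsilon> * (6 + \<bar>c $ 2\<bar> + \<bar>c $ 4\<bar>)"
proof -
  let ?X = "figure_eight_torus c \<epsilon> w - c" and ?u = "Re w" and ?v = "Im w"
  have \<epsilon>: "\<bar>\<epsilon> * a\<bar> \<le> \<epsilon>" if "\<bar>a\<bar> \<le> 1" for a :: real
    using mult_left_mono[OF that, of \<epsilon>] assms by (simp add: abs_mult)
  have "\<bar>?X $ 5\<bar> \<le> \<bar>c $ 2\<bar> * \<bar>\<epsilon> * cos ?u\<bar> + \<bar>c $ 4\<bar> * \<bar>\<epsilon> * cos ?v\<bar>
      + 2 / 3 * (\<epsilon> * (\<bar>\<epsilon> * sin ?u ^ 3\<bar> + \<bar>\<epsilon> * sin ?v ^ 3\<bar>))"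
  proof -
    have "?X $ 5 = c $ 2 * (\<epsilon> * cos ?u) + c $ 4 * (\<epsilon> * cos ?v)
        - 2 / 3 * (\<epsilon> * (\<epsilon> * sin ?u ^ 3 + \<epsilon> * sin ?v ^ 3))"
      by (simp add: figure_eight_torus_def Let_def power2_eq_square algebra_simps)
    moreover have "\<bar>\<epsilon> * (\<epsilon> * sin ?u ^ 3 + \<epsilon> * sin ?v ^ 3)\<bar> \<le> \<epsilon> * (\<bar>\<epsilon> * sin ?u ^ 3\<bar> + \<bar>\<epsilon> * sin ?v ^ 3\<bar>)"
      unfolding abs_mult[of \<epsilon> "_ + _"] using assms by (auto intro!: mult_mono)
    ultimately show ?thesis
      unfolding abs_mult[of "c $ _", symmetric] by linarith
  qed
  also have "\<dots> \<le> \<bar>c $ 2\<bar> * \<epsilon> + \<bar>c $ 4\<bar> * \<epsilon> + 2 / 3 * (1 * (\<epsilon> + \<epsilon>))"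
    using assms by (intro add_mono mult_mono \<epsilon>) (auto simp: power_abs power_le_one)
  finally have X5: "\<bar>?X $ 5\<bar> \<le> \<epsilon> * (2 + \<bar>c $ 2\<bar> + \<bar>c $ 4\<bar>)"
    using assms by (simp add: algebra_simps)
  have "norm ?X \<le> (\<Sum>i\<in>UNIV. \<bar>?X $ i\<bar>)"
    by (rule norm_le_l1_cart)
  also have "\<dots> = \<bar>\<epsilon> * cos ?u\<bar> + \<bar>\<epsilon> * sin (2 * ?u)\<bar> + \<bar>\<epsilon> * cos ?v\<bar> + \<bar>\<epsilon> * sin (2 * ?v)\<bar> + \<bar>?X $ 5\<bar>"
    by (simp add: sum_5 figure_eight_torus_def Let_def)
  also have "\<dots> \<le> \<epsilon> + \<epsilon> + \<epsilon> + \<epsilon> + \<epsilon> * (2 + \<bar>c $ 2\<bar> + \<bar>c $ 4\<bar>)"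
    by (intro add_mono \<epsilon> X5) auto
  finally show ?thesis by (simp add: algebra_simps)
qed

section \<open>Assembling the immersion of the disk\<close>

theorem mainTheorem6:
  fixes c :: "real^5" and r :: real
  assumes "r > 0"
  shows "\<exists>L :: complex \<Rightarrow> real^5.
    complete_immersion_on unit_disk L \<and> legendrian_on unit_disk L \<and> L ` unit_disk \<subseteq> ball c r"
proof -
  \<comment> \<open>Using 7 where the estimate has 6 leaves a margin of \<open>\<epsilon>\<close>,
    which yields the strict inequality for the open ball.\<close>
  define \<epsilon> where "\<epsilon> = min 1 (r / (7 + \<bar>c $ 2\<bar> + \<bar>c $ 4\<bar>))"
  have \<epsilon>: "0 < \<epsilon>" "\<epsilon> \<le> 1"
    using assms by (auto simp: \<epsilon>_def)
  have "\<epsilon> \<le> r / (7 + \<bar>c $ 2\<bar> + \<bar>c $ 4\<bar>)"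
    by (simp add: \<epsilon>_def)
  then have "\<epsilon> * (7 + \<bar>c $ 2\<bar> + \<bar>c $ 4\<bar>) \<le> r"
    by (simp add: pos_le_divide_eq)
  then have small: "\<epsilon> * (6 + \<bar>c $ 2\<bar> + \<bar>c $ 4\<bar>) < r"
    using \<epsilon> by (simp add: algebra_simps)
  define L where "L = (\<lambda>z. figure_eight_torus c \<epsilon> (ball_dilation z))"
  have disk: "unit_disk = ball 0 1" by auto
  have smooth: "Ck_on k (ball 0 1) L" for k
    unfolding L_def by (intro Ck_on_figure_eight_torus Ck_on_ball_dilation open_ball)
  have D: "frechet_derivative L (at z) v =
      figure_eight_torus' c \<epsilon> (ball_dilation z) (frechet_derivative ball_dilation (at z) v)"
    if "z \<in> ball 0 1" for z v
  proof -
    have "(ball_dilation has_derivative frechet_derivative ball_dilation (at z)) (at z)"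
      using Ck_on_1D(1)[OF Ck_on_ball_dilation that] .
    from diff_chain_at[OF this has_derivative_figure_eight_torus[of c \<epsilon>]]
    have "(L has_derivative (\<lambda>v. figure_eight_torus' c \<epsilon> (ball_dilation z)
        (frechet_derivative ball_dilation (at z) v))) (at z)"
      by (simp add: L_def o_def)
    from fun_cong[OF frechet_derivative_at[OF this], of v] show ?thesis by simp
  qed
  \<comment> \<open>This one estimate serves twice: it transfers injectivity of the differential
    from \<open>ball_dilation\<close> to \<open>L\<close>, and it is the comparison required for
    completeness with \<open>\<delta> = \<epsilon> / 2\<close>.\<close>
  have expand: "\<epsilon> / 2 * norm (frechet_derivative ball_dilation (at z) v) \<le> norm (frechet_derivative L (at z) v)"
    if "z \<in> ball 0 1" for z v
    unfolding D[OF that] by (rule norm_figure_eight_torus'_ge[OF \<epsilon>(1)])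
  have "inj (frechet_derivative L (at z))" if z: "z \<in> ball 0 1" for z
  proof -
    have lin: "linear (frechet_derivative L (at z))"
      by (rule linear_frechet_derivative, rule differentiableI[OF Ck_on_1D(1)[OF smooth z]])
    have lin': "linear (frechet_derivative ball_dilation (at z))"
      by (rule linear_frechet_derivative, rule differentiableI[OF Ck_on_1D(1)[OF Ck_on_ball_dilation z]])
    have inj': "inj (frechet_derivative ball_dilation (at z))"
      using inj_ball_dilation_derivative[of z] z by simp
    show ?thesis
      unfolding linear_injective_0[OF lin]
    proof (intro allI impI)
      fix v assume "frechet_derivative L (at z) v = 0"
      with expand[OF z, of v] \<epsilon> have "frechet_derivative ball_dilation (at z) v = 0"
        by (simp add: mult_le_0_iff)
      with inj' show "v = 0"
        unfolding linear_injective_0[OF lin'] by blast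
    qed
  qed
  moreover have "complete_riemannian_metric (ball 0 1) (pullback_metric L)"
    by (rule complete_riemannian_metric_pullback_metric[OF open_ball convex_ball smooth
          Ck_on_ball_dilation inj_on_ball_dilation _ expand ball_dilation_proper])
      (use \<epsilon> in simp)
  moreover have "legendrian_on (ball 0 1) L"
    unfolding legendrian_on_def pullback_form_def
  proof (intro ballI allI)
    fix z :: complex and v assume z: "z \<in> ball 0 1"
    show "contact_form (L z) (frechet_derivative L (at z) v) = 0"
      unfolding D[OF z] unfolding L_def by (rule contact_form_figure_eight_torus')
  qed
  moreover have "L ` ball 0 1 \<subseteq> ball c r"
    using le_less_trans[OF norm_figure_eight_torus_diff_le[OF \<epsilon>] small]
    by (auto simp: L_def dist_norm norm_minus_commute)
  ultimately show ?thesis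
    unfolding disk complete_immersion_on_def smooth_immersion_on_def smooth_on_def
    using smooth by blast
qed

end
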